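(* The function $y=E_4'\,\Delta^{-1/2}$ on $\mathcal H$ is a solution to $$y''\,+\,\pi^2E_4\,y\,=\,0.$$
   Context: $\mathcal H=\{z\in\mathbb C:\Im z>0\}$ is the upper half-plane, and $'$ denotes $d/dz$. With $q=e^{2\pi i z}$, the Eisenstein series $E_4$ is $E_4(z)=1+240\sum_{n\ge1}\sigma_3(n)q^n$, where $\sigma_3(n)$ is the sum of the cubes of the positive divisors of $n$. The Dedekind eta-function is $\eta(z)=q^{1/24}\prod_{n\ge1}(1-q^n)$ with $q^{1/24}=e^{2\pi i z/24}$, the discriminant is $\Delta=\eta^{24}$, and $\Delta^{-1/2}=\eta^{-12}$. *)

theory Defs
  imports "HOL-Complex_Analysis.Complex_Analysis"
begin

definition upper_half_plane :: "complex set" where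
  "upper_half_plane = {z. 0 < Im z}"

text \<open>The power \<open>q\<^sup>a\<close> for a real exponent \<open>a\<close>, i.e. the branch \<open>exp (2 \<pi> \<i> a z)\<close>.\<close>

definition qpow :: "real \<Rightarrow> complex \<Rightarrow> complex" where
  "qpow a z = exp (2 * of_real pi * \<i> * of_real a * z)"

abbreviation nome :: "complex \<Rightarrow> complex" where
  "nome z \<equiv> qpow 1 z"

definition divisor_sum :: "nat \<Rightarrow> nat \<Rightarrow> nat" where
  "divisor_sum k n = (\<Sum>d | d dvd n. d ^ k)"

text \<open>The series and the product below start at \<open>1\<close>, whence the shift to \<open>Suc n\<close>.
  The functions are meant on the upper half-plane, where both converge; their values
  elsewhere are irrelevant.\<close>

definition E4 :: "complex \<Rightarrow> complex" where
  "E4 z = 1 + 240 * (\<Sum>n. of_nat (divisor_sum 3 (Suc n)) * nome z ^ Suc n)"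

definition dedekind_eta :: "complex \<Rightarrow> complex" where
  "dedekind_eta z = qpow (1 / 24) z * (\<Prod>n. 1 - nome z ^ Suc n)"

definition Delta :: "complex \<Rightarrow> complex" where
  "Delta z = dedekind_eta z ^ 24"

text \<open>The root of \<open>Delta\<close> is fixed by \<open>dedekind_eta\<close>; it is not the principal branch.\<close>

definition Delta_inv_sqrt :: "complex \<Rightarrow> complex" where
  "Delta_inv_sqrt z = dedekind_eta z powi (- 12)"

lemma Delta_inv_sqrt_squared: "Delta_inv_sqrt z ^ 2 = inverse (Delta z)"
  by (simp add: Delta_inv_sqrt_def Delta_def power_int_minus power_inverse
      flip: power_mult)

end

theory Submission
  imports Defs
begin

text \<open>
  Write \<open>D\<close> for \<open>q d/dq\<close>. Since \<open>D \<eta> = E\<^sub>2 \<eta> / 24\<close>, the equation only involves \<open>E\<^sub>2\<close>, \<open>E\<^sub>4\<close> and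
  their derivatives, and it follows by algebra from Ramanujan's identity
  \<open>E\<^sub>4 = E\<^sub>2\<^sup>2 - 12 D E\<^sub>2\<close> and Chazy's equation \<open>2 D\<^sup>3 E\<^sub>2 = 2 E\<^sub>2 D\<^sup>2 E\<^sub>2 - 3 (D E\<^sub>2)\<^sup>2\<close>.
  On coefficients these two say that
  \<open>12 \<Sum> \<sigma>(m) \<sigma>(k) = 5 \<sigma>\<^sub>3(n) - (6 n - 1) \<sigma>(n)\<close> and
  \<open>12 \<Sum> m k \<sigma>(m) \<sigma>(k) = n\<^sup>2 (\<sigma>\<^sub>3(n) - n \<sigma>(n))\<close>, summed over \<open>m + k = n\<close>.

  No modularity is needed for the latter. The sums run over the positive solutions of
  \<open>a x + b y = n\<close>, and \<open>(a, b, x, y) \<mapsto> (x + y, x, b, a - b)\<close> is an involution \<open>S\<close> of those with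
  \<open>a > b\<close>. If a polynomial \<open>G\<close> is invariant under exchanging the two products and equals
  \<open>h - h \<circ> S\<close> for some \<open>h\<close>, then its sum over all solutions reduces to the diagonal \<open>a = b\<close>,
  where it is a divisor sum. Both identities arise from suitable \<open>G\<close> and \<open>h\<close>, found by linear
  algebra on polynomials of degree 2 and 6.
\<close>

subsection \<open>Convolutions of divisor sums\<close>

text \<open>Choosing m + k = n, a divisor a of m and a divisor b of k amounts to choosing such a
  quadruple, with cofactors x and y. Sums over this set are therefore convolutions of divisor
  sums.\<close>

definition two_products :: "nat \<Rightarrow> (nat \<times> nat \<times> nat \<times> nat) set" where
  "two_products n = {(a, b, x, y). a > 0 \<and> b > 0 \<and> x > 0 \<and> y > 0 \<and> a * x + b * y = n}"

lemma finite_two_products [simp]: "finite (two_products n)"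
proof (rule finite_subset)
  show "two_products n \<subseteq> {..n} \<times> {..n} \<times> {..n} \<times> {..n}"
  proof (clarsimp simp: two_products_def, intro conjI)
    fix a b x y :: nat
    assume pos: "0 < a" "0 < b" "0 < x" "0 < y"
    then have "a * 1 \<le> a * x" "b * 1 \<le> b * y" "1 * x \<le> a * x" "1 * y \<le> b * y"
      by (intro mult_le_mono; simp)+
    then show "a \<le> a * x + b * y" "b \<le> a * x + b * y" "x \<le> a * x + b * y" "y \<le> a * x + b * y"
      by linarith+
  qed
qed simp

text \<open>A divisor and its cofactor can trade places in one product without touching the other.
  This identifies the sums of different monomials below.\<close>

lemma sum_two_products_exchange_left:
  "(\<Sum>(a, b, x, y)\<in>two_products n. f a b x y) = (\<Sum>(a, b, x, y)\<in>two_products n. f x b a y)"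
  by (rule sum.reindex_bij_witness[where i = "\<lambda>(a, b, x, y). (x, b, a, y)" and j = "\<lambda>(a, b, x, y). (x, b, a, y)"])
     (auto simp: two_products_def mult.commute)

lemma sum_two_products_exchange_right:
  "(\<Sum>(a, b, x, y)\<in>two_products n. f a b x y) = (\<Sum>(a, b, x, y)\<in>two_products n. f a y x b)"
  by (rule sum.reindex_bij_witness[where i = "\<lambda>(a, b, x, y). (a, y, x, b)" and j = "\<lambda>(a, b, x, y). (a, y, x, b)"])
     (auto simp: two_products_def mult.commute)

text \<open>Exchanging the two products maps a < b onto a > b, so both parts have the same sum. That
  sum is 0: \<open>?S\<close> keeps n fixed because (x + y) b + x (a - b) = a x + b y, so h and its
  composite with \<open>?S\<close> have equal sums over a > b. On a = b = d the equation becomes x +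
  y = n / d.\<close>

lemma sum_two_products_diagonal:
  fixes G h :: "int \<Rightarrow> int \<Rightarrow> int \<Rightarrow> int \<Rightarrow> int"
  assumes sym: "\<And>a b x y. G b a y x = G a b x y"
    and coboundary: "\<And>a b x y. G a b x y = h a b x y - h (x + y) x b (a - b)"
  shows "(\<Sum>(a, b, x, y)\<in>two_products n. G (int a) (int b) (int x) (int y)) =
    (\<Sum>d | d dvd n. \<Sum>x = 1..<n div d. G (int d) (int d) (int x) (int (n div d - x)))"
proof -
  let ?G = "\<lambda>(a, b, x, y). G (int a) (int b) (int x) (int y)"
  let ?h = "\<lambda>(a, b, x, y). h (int a) (int b) (int x) (int y)"
  let ?S = "\<lambda>(a, b, x, y). (x + y, x, b, a - b)"
  define A where "A = {(a, b, x, y) \<in> two_products n. b < a}"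
  define B where "B = {(a, b, x, y) \<in> two_products n. a < b}"
  define D where "D = {(a, b, x, y) \<in> two_products n. a = b}"
  have fin: "finite A" "finite B" "finite D"
    unfolding A_def B_def D_def by (auto intro: finite_subset[OF _ finite_two_products])
  have S_A: "?S t \<in> A" if "t \<in> A" for t
  proof -
    from that obtain a b x y where t: "t = (a, b, x, y)" "b < a" "0 < b" "0 < x" "0 < y" "a * x + b * y = n"
      by (auto simp: A_def two_products_def)
    \<comment> \<open>Writing a = b + c removes the truncated subtraction.\<close>
    moreover from \<open>b < a\<close> obtain c where "a = b + c" by (metis less_imp_add_positive)
    ultimately show ?thesis
      by (auto simp: A_def two_products_def algebra_simps)
  qed
  have "sum ?h A = sum (?h \<circ> ?S) A"
    by (rule sum.reindex_bij_witness[where i = ?S and j = ?S])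
       (use S_A in \<open>auto simp: A_def\<close>)
  then have "sum ?G A = 0"
  proof -
    \<comment> \<open>The assumption \<open>coboundary\<close> is about integers; b < a on
      \<open>A\<close> makes the subtraction of naturals agree with theirs.\<close>
    have "sum ?G A = (\<Sum>t\<in>A. ?h t - (?h \<circ> ?S) t)"
      by (rule sum.cong) (auto simp: A_def of_nat_diff intro!: coboundary)
    then show ?thesis
      using \<open>sum ?h A = _\<close> by (simp add: sum_subtractf)
  qed
  moreover have "sum ?G B = sum ?G A"
    by (rule sum.reindex_bij_witness[where i = "\<lambda>(a, b, x, y). (b, a, y, x)" and j = "\<lambda>(a, b, x, y). (b, a, y, x)"])
       (auto simp: A_def B_def two_products_def sym)
  moreover have "sum ?G (two_products n) = sum ?G A + sum ?G B + sum ?G D"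
  proof -
    have "A \<inter> B = {}" "(A \<union> B) \<inter> D = {}" "two_products n = (A \<union> B) \<union> D"
      by (auto simp: A_def B_def D_def)
    then show ?thesis
      using fin by (simp add: sum.union_disjoint)
  qed
  moreover have "sum ?G D = (\<Sum>d | d dvd n. \<Sum>x = 1..<n div d. G (int d) (int d) (int x) (int (n div d - x)))"
  \<comment> \<open>The divisors of 0 form an infinite set, so the sum over pairs (d, x) is formed
    for n > 0 only.\<close>
  proof (cases "n = 0")
    case True
    then have "D = {}" by (auto simp: D_def two_products_def)
    then show ?thesis using True by simp
  next
    case False
    then have "(\<Sum>d | d dvd n. \<Sum>x = 1..<n div d. G (int d) (int d) (int x) (int (n div d - x)))
      = (\<Sum>(d, x)\<in>(SIGMA d:{d. d dvd n}. {1..<n div d}). G (int d) (int d) (int x) (int (n div d - x)))"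
      by (subst sum.Sigma) auto
    also have "\<dots> = sum ?G D"
    proof (rule sum.reindex_bij_witness[where i = "\<lambda>(a, b, x, y). (a, x)" and j = "\<lambda>(d, x). (d, d, x, n div d - x)"])
      fix t assume "t \<in> (SIGMA d:{d. d dvd n}. {1..<n div d})"
      then obtain d x where t: "t = (d, x)" "d dvd n" "1 \<le> x" "x < n div d" by auto
      have "d > 0" using t False by (auto intro: Nat.gr0I)
      have "d * x + d * (n div d - x) = n"
        using t by (metis add_mult_distrib2 dvd_mult_div_cancel le_add_diff_inverse less_imp_le_nat)
      then show "(case t of (d, x) \<Rightarrow> (d, d, x, n div d - x)) \<in> D"
        using t \<open>d > 0\<close> by (auto simp: D_def two_products_def)
    qed (auto simp: D_def two_products_def simp flip: add_mult_distrib2)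
    finally show ?thesis ..
  qed
  ultimately show ?thesis by simp
qed

text \<open>Every d divides 0, and a sum over an infinite set is 0 by default. Hence convolutions
  may run over all m \<le> n, and the generating series have no constant term.\<close>

lemma divisor_sum_0 [simp]: "divisor_sum k 0 = 0"
  by (simp add: divisor_sum_def)

lemma sum_divisors_complement:
  fixes f :: "nat \<Rightarrow> 'a :: comm_monoid_add"
  assumes "n > 0"
  shows "(\<Sum>d | d dvd n. f (n div d)) = (\<Sum>d | d dvd n. f d)"
  by (rule sum.reindex_bij_witness[where i = "\<lambda>d. n div d" and j = "\<lambda>d. n div d"])
     (use assms in auto)

lemma sum_divisor_sum_convolution:
  fixes g :: "nat \<Rightarrow> nat \<Rightarrow> int"
  shows "(\<Sum>m\<le>n. g m (n - m) * int (divisor_sum j m) * int (divisor_sum k (n - m))) =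
    (\<Sum>(a, b, x, y)\<in>two_products n. g (a * x) (b * y) * int a ^ j * int b ^ k)"
proof -
  let ?U = "SIGMA m:{0<..<n}. {a. a dvd m} \<times> {b. b dvd n - m}"
  have "(\<Sum>m\<le>n. g m (n - m) * int (divisor_sum j m) * int (divisor_sum k (n - m))) =
    (\<Sum>m\<in>{0<..<n}. g m (n - m) * int (divisor_sum j m) * int (divisor_sum k (n - m)))"
  proof (rule sum.mono_neutral_right)
    show "\<forall>m\<in>{..n} - {0<..<n}. g m (n - m) * int (divisor_sum j m) * int (divisor_sum k (n - m)) = 0"
    proof
      fix m assume "m \<in> {..n} - {0<..<n}"
      then have "m = 0 \<or> m = n" by auto
      then show "g m (n - m) * int (divisor_sum j m) * int (divisor_sum k (n - m)) = 0" by auto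
    qed
  qed auto
  also have "\<dots> = (\<Sum>m\<in>{0<..<n}. \<Sum>(a, b)\<in>{a. a dvd m} \<times> {b. b dvd n - m}.
      g m (n - m) * int a ^ j * int b ^ k)"
  proof (rule sum.cong)
    fix m
    have "int (divisor_sum j m) * int (divisor_sum k (n - m)) =
        (\<Sum>(a, b)\<in>{a. a dvd m} \<times> {b. b dvd n - m}. int a ^ j * int b ^ k)"
      by (simp add: divisor_sum_def sum_product sum.cartesian_product)
    then show "g m (n - m) * int (divisor_sum j m) * int (divisor_sum k (n - m)) =
        (\<Sum>(a, b)\<in>{a. a dvd m} \<times> {b. b dvd n - m}. g m (n - m) * int a ^ j * int b ^ k)"
      by (simp add: sum_distrib_left case_prod_unfold mult.assoc)
  qed simp
  also have "\<dots> = (\<Sum>(m, a, b)\<in>?U. g m (n - m) * int a ^ j * int b ^ k)"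
    by (subst sum.Sigma) (auto simp: case_prod_unfold)
  also have "\<dots> = (\<Sum>(a, b, x, y)\<in>two_products n. g (a * x) (b * y) * int a ^ j * int b ^ k)"
  proof (rule sum.reindex_bij_witness[where i = "\<lambda>(a, b, x, y). (a * x, a, b)"
        and j = "\<lambda>(m, a, b). (a, b, m div a, (n - m) div b)"])
    fix t assume "t \<in> ?U"
    then obtain m a b where t: "t = (m, a, b)" "0 < m" "m < n" "a dvd m" "b dvd n - m" by auto
    have "a > 0" "b > 0" using t by (auto intro!: Nat.gr0I)
    moreover have "m div a > 0" "(n - m) div b > 0"
      using t \<open>a > 0\<close> \<open>b > 0\<close> by (auto simp: div_greater_zero_iff dvd_imp_le)
    ultimately show "(case t of (m, a, b) \<Rightarrow> (a, b, m div a, (n - m) div b)) \<in> two_products n"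
      using t by (auto simp: two_products_def)
  qed (auto simp: two_products_def)
  finally show ?thesis .
qed

section \<open>The two convolution identities\<close>

lemma sum_divisors_cofactor:
  assumes "n > 0"
  shows "(\<Sum>d | d dvd n. int (n div d) ^ k) = int (divisor_sum k n)"
  using sum_divisors_complement[OF assms, of "\<lambda>d. int d ^ k"] by (simp add: divisor_sum_def)

text \<open>Under the exchanges the squares in \<open>G\<close> cancel and x y contributes as much
  as a b, so \<open>G\<close> sums to twice the convolution. The further factor 6 clears the
  denominators of the sum of squares on the diagonal.\<close>

theorem sum_divisor_sum_1_1:
  "12 * (\<Sum>m\<le>n. int (divisor_sum 1 m) * int (divisor_sum 1 (n - m))) =
    5 * int (divisor_sum 3 n) - (6 * int n - 1) * int (divisor_sum 1 n)"
proof (cases "n = 0")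
  case False
  define G :: "int \<Rightarrow> int \<Rightarrow> int \<Rightarrow> int \<Rightarrow> int"
    where "G a b x y = a * b + x * y + x ^ 2 + y ^ 2 - a ^ 2 - b ^ 2" for a b x y
  let ?\<Sigma> = "\<lambda>f. \<Sum>(a, b, x, y)\<in>two_products n. f (int a) (int b) (int x) (int y)"
  have "?\<Sigma> G = ?\<Sigma> (\<lambda>a b x y. a * b) + ?\<Sigma> (\<lambda>a b x y. x * y) + ?\<Sigma> (\<lambda>a b x y. x ^ 2)
      + ?\<Sigma> (\<lambda>a b x y. y ^ 2) - ?\<Sigma> (\<lambda>a b x y. a ^ 2) - ?\<Sigma> (\<lambda>a b x y. b ^ 2)"
    by (simp add: G_def case_prod_unfold sum.distrib sum_subtractf)
  also have "?\<Sigma> (\<lambda>a b x y. x * y) = ?\<Sigma> (\<lambda>a b x y. a * b)"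
    by (subst sum_two_products_exchange_left, subst sum_two_products_exchange_right) simp
  also have "?\<Sigma> (\<lambda>a b x y. x ^ 2) = ?\<Sigma> (\<lambda>a b x y. a ^ 2)"
    by (subst sum_two_products_exchange_left) simp
  also have "?\<Sigma> (\<lambda>a b x y. y ^ 2) = ?\<Sigma> (\<lambda>a b x y. b ^ 2)"
    by (subst sum_two_products_exchange_right) simp
  also have "?\<Sigma> (\<lambda>a b x y. a * b) = (\<Sum>m\<le>n. int (divisor_sum 1 m) * int (divisor_sum 1 (n - m)))"
    using sum_divisor_sum_convolution[where g = "\<lambda>_ _. 1" and j = 1 and k = 1 and n = n] by simp
  finally have "12 * (\<Sum>m\<le>n. int (divisor_sum 1 m) * int (divisor_sum 1 (n - m))) = 6 * ?\<Sigma> G"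
    by simp
  \<comment> \<open>Composing h with the involution gives b^2 + b (a - b) + (a - b)^2 = a^2 - a b +
    b^2, and h minus this is \<open>G\<close>.\<close>
  also have "\<dots> = (\<Sum>d | d dvd n. 6 * (\<Sum>x = 1..<n div d. G (int d) (int d) (int x) (int (n div d - x))))"
    by (subst sum_two_products_diagonal[where h = "\<lambda>a b x y. x ^ 2 + x * y + y ^ 2"])
       (simp_all add: G_def algebra_simps power2_eq_square sum_distrib_left)
  also have "\<dots> = (\<Sum>d | d dvd n. 5 * int (n div d) ^ 3 - 6 * int (n div d) ^ 2 + int (n div d) ^ 1
      - 6 * int n * int d ^ 1 + 6 * int d ^ 2)"
  proof (rule sum.cong)
    fix d assume "d \<in> {d. d dvd n}"
    then obtain e where e: "n = d * e" "d > 0" "e > 0" using False by (auto elim!: dvdE)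
    \<comment> \<open>With y = e - x the diagonal value of \<open>G\<close> is e^2 - e x + x^2 -
      d^2. The closed form is proved for a free upper bound, then used with M = e - 1.\<close>
    have "6 * (\<Sum>x = 1..<Suc M. c ^ 2 - c * int x + int x ^ 2 - b) =
      6 * (c ^ 2 - b) * int M - 3 * c * int M * (int M + 1) + int M * (int M + 1) * (2 * int M + 1)" for M and b c :: int
      by (induction M) (simp_all add: algebra_simps power2_eq_square)
    from this[of "int e" "int d ^ 2" "e - 1"]
    have "6 * (\<Sum>x = 1..<e. int e ^ 2 - int e * int x + int x ^ 2 - int d ^ 2) =
      5 * int e ^ 3 - 6 * int e ^ 2 + int e - 6 * int d ^ 2 * int e + 6 * int d ^ 2"
      using e by (simp add: of_nat_diff algebra_simps power2_eq_square power3_eq_cube)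
    also have "(\<Sum>x = 1..<e. int e ^ 2 - int e * int x + int x ^ 2 - int d ^ 2) =
      (\<Sum>x = 1..<e. G (int d) (int d) (int x) (int (e - x)))"
      by (rule sum.cong) (auto simp: G_def of_nat_diff algebra_simps power2_eq_square)
    finally show "6 * (\<Sum>x = 1..<n div d. G (int d) (int d) (int x) (int (n div d - x))) =
      5 * int (n div d) ^ 3 - 6 * int (n div d) ^ 2 + int (n div d) ^ 1 - 6 * int n * int d ^ 1 + 6 * int d ^ 2"
      using e by (simp add: power2_eq_square mult_ac)
  qed simp
  \<comment> \<open>As d runs over the divisors of n, so does n / d; the two squares therefore
    cancel.\<close>
  also have "\<dots> = 5 * int (divisor_sum 3 n) - (6 * int n - 1) * int (divisor_sum 1 n)"
    unfolding sum.distrib sum_subtractf sum_distrib_left[symmetric] sum_divisors_cofactor[OF False[simplified]]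
    by (simp add: divisor_sum_def algebra_simps)
  finally show ?thesis .
qed simp

text \<open>Since a^2 b^2 x y = (a x) (b y) a b, each of the first two terms of \<open>G\<close>
  sums to 6 times the convolution. The four differences sum to 0 by exchanges; they complete
  \<open>G\<close> to a coboundary.\<close>

theorem sum_weighted_divisor_sum_1_1:
  "12 * (\<Sum>m\<le>n. int m * int (n - m) * int (divisor_sum 1 m) * int (divisor_sum 1 (n - m))) =
    int n ^ 2 * (int (divisor_sum 3 n) - int n * int (divisor_sum 1 n))"
proof (cases "n = 0")
  case False
  define G :: "int \<Rightarrow> int \<Rightarrow> int \<Rightarrow> int \<Rightarrow> int"
    where "G a b x y = 6 * (a ^ 2 * b ^ 2 * x * y) + 6 * (a * b * x ^ 2 * y ^ 2)
      + (b ^ 2 * y ^ 4 - b ^ 4 * y ^ 2) + (a ^ 2 * x ^ 4 - a ^ 4 * x ^ 2)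
      + 4 * (a * b * x * y ^ 3 - a * b ^ 3 * x * y) + 4 * (a * b * x ^ 3 * y - a ^ 3 * b * x * y)" for a b x y
  let ?\<Sigma> = "\<lambda>f. \<Sum>(a, b, x, y)\<in>two_products n. f (int a) (int b) (int x) (int y)"
  have "?\<Sigma> G = 6 * ?\<Sigma> (\<lambda>a b x y. a ^ 2 * b ^ 2 * x * y) + 6 * ?\<Sigma> (\<lambda>a b x y. a * b * x ^ 2 * y ^ 2)
      + (?\<Sigma> (\<lambda>a b x y. b ^ 2 * y ^ 4) - ?\<Sigma> (\<lambda>a b x y. b ^ 4 * y ^ 2))
      + (?\<Sigma> (\<lambda>a b x y. a ^ 2 * x ^ 4) - ?\<Sigma> (\<lambda>a b x y. a ^ 4 * x ^ 2))
      + 4 * (?\<Sigma> (\<lambda>a b x y. a * b * x * y ^ 3) - ?\<Sigma> (\<lambda>a b x y. a * b ^ 3 * x * y))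
      + 4 * (?\<Sigma> (\<lambda>a b x y. a * b * x ^ 3 * y) - ?\<Sigma> (\<lambda>a b x y. a ^ 3 * b * x * y))"
    unfolding G_def case_prod_unfold sum.distrib sum_subtractf sum_distrib_left[symmetric] ..
  also have "?\<Sigma> (\<lambda>a b x y. a * b * x ^ 2 * y ^ 2) = ?\<Sigma> (\<lambda>a b x y. a ^ 2 * b ^ 2 * x * y)"
    by (subst sum_two_products_exchange_left, subst sum_two_products_exchange_right) (simp add: mult_ac)
  also have "?\<Sigma> (\<lambda>a b x y. b ^ 2 * y ^ 4) = ?\<Sigma> (\<lambda>a b x y. b ^ 4 * y ^ 2)"
    by (subst sum_two_products_exchange_right) (simp add: mult_ac)
  also have "?\<Sigma> (\<lambda>a b x y. a ^ 2 * x ^ 4) = ?\<Sigma> (\<lambda>a b x y. a ^ 4 * x ^ 2)"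
    by (subst sum_two_products_exchange_left) (simp add: mult_ac)
  also have "?\<Sigma> (\<lambda>a b x y. a * b * x * y ^ 3) = ?\<Sigma> (\<lambda>a b x y. a * b ^ 3 * x * y)"
    by (subst sum_two_products_exchange_right) (simp add: mult_ac)
  also have "?\<Sigma> (\<lambda>a b x y. a * b * x ^ 3 * y) = ?\<Sigma> (\<lambda>a b x y. a ^ 3 * b * x * y)"
    by (subst sum_two_products_exchange_left) (simp add: mult_ac)
  also have "?\<Sigma> (\<lambda>a b x y. a ^ 2 * b ^ 2 * x * y) =
      (\<Sum>m\<le>n. int m * int (n - m) * int (divisor_sum 1 m) * int (divisor_sum 1 (n - m)))"
    using sum_divisor_sum_convolution[where g = "\<lambda>u v. int u * int v" and j = 1 and k = 1 and n = n]
    by (simp add: power2_eq_square mult_ac)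
  finally have "12 * (\<Sum>m\<le>n. int m * int (n - m) * int (divisor_sum 1 m) * int (divisor_sum 1 (n - m))) = ?\<Sigma> G"
    by simp
  also have "\<dots> = (\<Sum>d | d dvd n. \<Sum>x = 1..<n div d. G (int d) (int d) (int x) (int (n div d - x)))"
    by (rule sum_two_products_diagonal[where h = "\<lambda>a b x y. b ^ 2 * y ^ 4 + b ^ 2 * x ^ 4 - b ^ 4 * y ^ 2
          - 2 * b ^ 4 * x * y + 4 * a * b * x * y ^ 3 + 6 * a * b * x ^ 2 * y ^ 2 + 4 * a * b * x ^ 3 * y"])
       (unfold G_def, algebra+)
  also have "\<dots> = (\<Sum>d | d dvd n. int n ^ 2 * (int (n div d) ^ 3 - int (n div d) ^ 2 - int n * int d ^ 1 + int d ^ 2))"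
  proof (rule sum.cong)
    fix d assume "d \<in> {d. d dvd n}"
    then obtain e where e: "n = d * e" "d > 0" "e > 0" using False by (auto elim!: dvdE)
    \<comment> \<open>The binomial formula collects \<open>G\<close> into d^2 (x + y)^4 - d^4 (x +
      y)^2, which is constant in x because x + y = e. The inner sum is then e - 1 times this
      value.\<close>
    have "G (int d) (int d) (int x) (int (e - x)) = int d ^ 2 * int e ^ 4 - int d ^ 4 * int e ^ 2"
      if "x \<in> {1..<e}" for x
    proof -
      have "int (e - x) = int e - int x" using that by simp
      then show ?thesis unfolding G_def by algebra
    qed
    then have "(\<Sum>x = 1..<e. G (int d) (int d) (int x) (int (e - x))) =
        (int e - 1) * (int d ^ 2 * int e ^ 4 - int d ^ 4 * int e ^ 2)"
      using e by (simp add: of_nat_diff)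
    also have "\<dots> = (int d * int e) ^ 2 * (int e ^ 3 - int e ^ 2 - (int d * int e) * int d ^ 1 + int d ^ 2)"
      by algebra
    finally show "(\<Sum>x = 1..<n div d. G (int d) (int d) (int x) (int (n div d - x))) =
      int n ^ 2 * (int (n div d) ^ 3 - int (n div d) ^ 2 - int n * int d ^ 1 + int d ^ 2)"
      using e by simp
  qed simp
  also have "\<dots> = int n ^ 2 * (int (divisor_sum 3 n) - int n * int (divisor_sum 1 n))"
    unfolding sum.distrib sum_subtractf sum_distrib_left[symmetric] sum_divisors_cofactor[OF False[simplified]]
    by (simp add: divisor_sum_def)
  finally show ?thesis .
qed simp

subsection \<open>Power series\<close>

text \<open>The operator q d/dq on formal power series.\<close>

definition theta :: "complex fps \<Rightarrow> complex fps" where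
  "theta f = fps_X * fps_deriv f"

lemma theta_nth [simp]: "fps_nth (theta f) n = of_nat n * fps_nth f n"
  by (cases n) (simp_all add: theta_def)

lemma theta_add: "theta (f + g) = theta f + theta g"
  and theta_diff: "theta (f - g) = theta f - theta g"
  and theta_mult: "theta (f * g) = theta f * g + f * theta g"
  and theta_1 [simp]: "theta 1 = 0"
  and theta_numeral [simp]: "theta (numeral k) = 0"
  by (simp_all add: theta_def algebra_simps)

lemma fps_conv_radius_theta: "fps_conv_radius f \<le> fps_conv_radius (theta f)"
  using fps_conv_radius_mult[of fps_X "fps_deriv f"] fps_conv_radius_deriv[of f]
  by (simp add: theta_def)

section \<open>Generating series of divisor sums and their convergence\<close>

definition divisor_series :: "nat \<Rightarrow> complex fps" where
  "divisor_series k = Abs_fps (\<lambda>n. of_nat (divisor_sum k n))"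

lemma divisor_series_nth [simp]: "fps_nth (divisor_series k) n = of_nat (divisor_sum k n)"
  by (simp add: divisor_series_def)

text \<open>There are at most n divisors, each at most n. Polynomial growth is enough for
  convergence in the unit disc.\<close>

lemma divisor_sum_le: "divisor_sum k n \<le> n ^ Suc k"
proof (cases "n = 0")
  case False
  have "divisor_sum k n \<le> (\<Sum>d = 1..n. n ^ k)"
    unfolding divisor_sum_def
  proof (rule sum_le_included[where i = "\<lambda>d. d"])
    show "\<forall>x\<in>{d. d dvd n}. \<exists>y\<in>{1..n}. y = x \<and> x ^ k \<le> n ^ k"
      using False by (auto intro!: power_mono Suc_leI Nat.gr0I simp: dvd_imp_le)
  qed (use False in auto)
  then show ?thesis by simp
qed simp

lemma norm_less_fps_conv_radius:
  "norm q < 1 \<Longrightarrow> 1 \<le> fps_conv_radius f \<Longrightarrow> norm q < fps_conv_radius f"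
  by (rule less_le_trans[where y = "ereal 1"]) (auto simp: one_ereal_def)

lemma fps_conv_radius_ge_1_intros:
  fixes f g :: "complex fps"
  shows "1 \<le> fps_conv_radius f \<Longrightarrow> 1 \<le> fps_conv_radius g \<Longrightarrow> 1 \<le> fps_conv_radius (f * g)"
    and "1 \<le> fps_conv_radius f \<Longrightarrow> 1 \<le> fps_conv_radius g \<Longrightarrow> 1 \<le> fps_conv_radius (f + g)"
    and "1 \<le> fps_conv_radius f \<Longrightarrow> 1 \<le> fps_conv_radius g \<Longrightarrow> 1 \<le> fps_conv_radius (f - g)"
    and "1 \<le> fps_conv_radius (numeral k :: complex fps)" "1 \<le> fps_conv_radius (1 :: complex fps)"
  using fps_conv_radius_mult[of f g] fps_conv_radius_add[of f g] fps_conv_radius_diff[of f g]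
  by (auto intro: order_trans[rotated])

lemma eval_fps_unit_disc:
  fixes q :: complex
  assumes "norm q < 1" "1 \<le> fps_conv_radius f" "1 \<le> fps_conv_radius g"
  shows "eval_fps (f * g) q = eval_fps f q * eval_fps g q"
    and "eval_fps (f + g) q = eval_fps f q + eval_fps g q"
    and "eval_fps (f - g) q = eval_fps f q - eval_fps g q"
  using assms by (simp_all add: eval_fps_mult eval_fps_add eval_fps_diff norm_less_fps_conv_radius)

text \<open>Applying \<open>theta\<close> k times to the geometric series produces the coefficients
  n^k, and \<open>theta\<close> does not shrink the radius of convergence.\<close>

lemma summable_power_mult_geometric:
  fixes r :: real
  assumes "0 \<le> r" "r < 1"
  shows "summable (\<lambda>n. real n ^ k * r ^ n)"
proof -
  define g :: "nat \<Rightarrow> complex fps" where "g k = (theta ^^ k) (Abs_fps (\<lambda>_. 1))" for k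
  have "1 \<le> fps_conv_radius (g k)"
  proof (induction k)
    case 0
    show ?case
      unfolding g_def fps_conv_radius_def
      by (auto intro!: conv_radius_geI_ex' summable_geometric)
  next
    case (Suc k)
    then show ?case using fps_conv_radius_theta[of "g k"] by (simp add: g_def)
  qed
  moreover have "fps_nth (g k) n = of_nat n ^ k" for n
    by (induction k) (simp_all add: g_def)
  ultimately have "summable (\<lambda>n. norm (of_nat n ^ k * complex_of_real r ^ n))"
    using norm_summable_fps[OF norm_less_fps_conv_radius[of "of_real r" "g k"]] assms by simp
  then show ?thesis using assms by (simp add: norm_mult norm_power)
qed

lemma fps_conv_radius_divisor_series: "1 \<le> fps_conv_radius (divisor_series k)"
  unfolding fps_conv_radius_def
proof (rule conv_radius_geI_ex')
  fix r :: real assume r: "0 < r" "ereal r < 1"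
  show "summable (\<lambda>n. fps_nth (divisor_series k) n * of_real r ^ n)"
  proof (rule summable_comparison_test')
    show "summable (\<lambda>n. real n ^ Suc k * r ^ n)"
      using r by (intro summable_power_mult_geometric) auto
    show "norm (fps_nth (divisor_series k) n * of_real r ^ n) \<le> real n ^ Suc k * r ^ n" for n
      using r divisor_sum_le[of k n]
      by (simp add: norm_mult norm_power mult_right_mono flip: of_nat_power of_nat_mult)
  qed
qed

section \<open>Series in the nome as functions of z\<close>

lemma norm_nome_less_1: "z \<in> upper_half_plane \<Longrightarrow> norm (nome z) < 1"
  by (simp add: upper_half_plane_def qpow_def norm_exp_eq_Re)

lemma qpow_has_field_derivative:
  "(qpow a has_field_derivative 2 * of_real pi * \<i> * of_real a * qpow a z) (at z within A)"
  unfolding qpow_def[abs_def] by (auto intro!: derivative_eq_intros simp: mult_ac)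

text \<open>Chain rule: the derivative of the nome is 2 pi i times the nome, and that factor q turns
  d/dq into q d/dq.\<close>

lemma eval_fps_nome_has_field_derivative:
  assumes "1 \<le> fps_conv_radius f" "z \<in> upper_half_plane"
  shows "((\<lambda>z. eval_fps f (nome z)) has_field_derivative
    2 * of_real pi * \<i> * eval_fps (theta f) (nome z)) (at z)"
proof -
  have *: "norm (nome z) < fps_conv_radius f"
    by (intro norm_less_fps_conv_radius norm_nome_less_1 assms)
  moreover have "norm (nome z) < fps_conv_radius (fps_deriv f)"
    using * fps_conv_radius_deriv[of f] by (rule less_le_trans)
  ultimately have "eval_fps (theta f) (nome z) = nome z * eval_fps (fps_deriv f) (nome z)"
    by (simp add: theta_def eval_fps_mult)
  then show ?thesis
    using DERIV_chain2[OF has_field_derivative_eval_fps[OF *] qpow_has_field_derivative[of 1]]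
    by (simp add: mult_ac)
qed

subsection \<open>The Euler product\<close>

text \<open>Both sides are groupings of one absolutely convergent double series with terms n q^(n
  m): by n it gives geometric series, by the product n m it gives divisor sums. All indices are
  shifted by one.\<close>

lemma lambert_series_divisor_sum_1:
  fixes q :: complex
  assumes q: "norm q < 1"
  shows "(\<lambda>n. of_nat (Suc n) * q ^ Suc n / (1 - q ^ Suc n)) sums eval_fps (divisor_series 1) q"
proof -
  let ?S = "eval_fps (divisor_series 1) q"
  define f where "f = (\<lambda>(N :: nat, d :: nat). of_nat d * q ^ Suc N)"
  define D where "D = (\<lambda>N. {d. d dvd Suc N})"
  have fin: "finite (D N)" for N by (simp add: D_def)
  have sum_D: "(\<Sum>d\<in>D N. f (N, d)) = of_nat (divisor_sum 1 (Suc N)) * q ^ Suc N" for N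
    by (simp add: f_def D_def divisor_sum_def sum_distrib_right)
  have q': "norm q < fps_conv_radius (divisor_series 1)"
    by (intro norm_less_fps_conv_radius fps_conv_radius_divisor_series q)
  have outer: "summable (\<lambda>N. norm (of_nat (divisor_sum 1 (Suc N)) * q ^ Suc N))"
    using norm_summable_fps[OF q'] by (subst (asm) summable_Suc_iff[symmetric]) simp
  have "(\<lambda>N. of_nat (divisor_sum 1 (Suc N)) * q ^ Suc N) sums ?S"
    using sums_eval_fps[OF q'] sums_Suc_iff[of "\<lambda>N. of_nat (divisor_sum 1 N) * q ^ N" ?S] by simp
  with outer have "((\<lambda>N. of_nat (divisor_sum 1 (Suc N)) * q ^ Suc N) has_sum ?S) UNIV"
    by (intro norm_summable_imp_has_sum)
  \<comment> \<open>For fixed N all terms carry the same power of q with nonnegative coefficients,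
    so their norms add up to the norm of the N-th term of the summable series
    \<open>outer\<close>.\<close>
  moreover have "(\<lambda>x. norm (f x)) summable_on Sigma UNIV D"
    unfolding Infinite_Sum.abs_summable_on_Sigma_iff
  proof (intro conjI ballI)
    have "(\<Sum>\<^sub>\<infinity>d\<in>D N. norm (f (N, d))) = norm (of_nat (divisor_sum 1 (Suc N)) * q ^ Suc N)" for N
      using fin by (subst norm_mult, subst norm_of_nat)
        (simp add: f_def D_def divisor_sum_def sum_distrib_right norm_mult norm_power)
    then show "(\<lambda>N. norm (\<Sum>\<^sub>\<infinity>d\<in>D N. norm (f (N, d)))) summable_on UNIV"
      using outer by (simp add: summable_on_UNIV_nonneg_real_iff)
  qed (use fin in auto)
  then have "f summable_on Sigma UNIV D"
    by (rule abs_summable_summable)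
  moreover have "((\<lambda>d. f (N, d)) has_sum of_nat (divisor_sum 1 (Suc N)) * q ^ Suc N) (D N)" for N
    using has_sum_finite[OF fin, of "\<lambda>d. f (N, d)" N] unfolding sum_D .
  ultimately have "(f has_sum ?S) (Sigma UNIV D)"
    by (intro has_sum_SigmaI[where g = "\<lambda>N. of_nat (divisor_sum 1 (Suc N)) * q ^ Suc N"])
  \<comment> \<open>The pair (N, d) corresponds to d = n + 1 and N + 1 = (n + 1) (m + 1).\<close>
  also have "?this \<longleftrightarrow> ((\<lambda>(n, m). of_nat (Suc n) * (q ^ Suc n) ^ Suc m) has_sum ?S) (UNIV \<times> UNIV)"
  proof (rule has_sum_reindex_bij_witness[where j = "\<lambda>(N, d). (d - 1, Suc N div d - 1)"
        and i = "\<lambda>(n, m). (Suc n * Suc m - 1, Suc n)"])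
    fix t assume "t \<in> Sigma UNIV D"
    then obtain N d where t: "t = (N, d)" "d dvd Suc N" by (auto simp: D_def)
    then have "d > 0" "d \<le> Suc N" by (auto intro!: Nat.gr0I simp: dvd_imp_le)
    then have "Suc N div d > 0" by (simp add: div_greater_zero_iff)
    with t \<open>d > 0\<close> show "(case case t of (N, d) \<Rightarrow> (d - 1, Suc N div d - 1) of (n, m) \<Rightarrow> (Suc n * Suc m - 1, Suc n)) = t"
      and "(case case t of (N, d) \<Rightarrow> (d - 1, Suc N div d - 1) of (n, m) \<Rightarrow> of_nat (Suc n) * (q ^ Suc n) ^ Suc m) = f t"
      by (simp_all add: f_def flip: power_mult del: power_Suc of_nat_Suc mult_Suc mult_Suc_right)
  next
    fix t :: "nat \<times> nat"
    obtain n m where t: "t = (n, m)" by (cases t)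
    have *: "Suc (Suc n * Suc m - 1) = Suc n * Suc m" by simp
    show "(case t of (n, m) \<Rightarrow> (Suc n * Suc m - 1, Suc n)) \<in> Sigma UNIV D"
      and "(case case t of (n, m) \<Rightarrow> (Suc n * Suc m - 1, Suc n) of (N, d) \<Rightarrow> (d - 1, Suc N div d - 1)) = t"
      unfolding t D_def mem_Sigma_iff prod.case mem_Collect_eq * by (simp_all del: mult_Suc mult_Suc_right)
  qed auto
  finally have "((\<lambda>n. of_nat (Suc n) * q ^ Suc n / (1 - q ^ Suc n)) has_sum ?S) UNIV"
  proof (rule has_sum_SigmaD)
    fix n :: nat
    have qn: "norm (q ^ Suc n) < 1"
      using q by (simp add: norm_power power_less_one_iff del: power_Suc)
    let ?c = "of_nat (Suc n) * q ^ Suc n"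
    have "(\<lambda>m. ?c * (q ^ Suc n) ^ m) sums (?c * (1 / (1 - q ^ Suc n)))"
      by (intro sums_mult geometric_sums qn)
    moreover have "summable (\<lambda>m. norm (?c * (q ^ Suc n) ^ m))"
      unfolding norm_mult norm_power[of "q ^ Suc n"] by (intro summable_mult summable_geometric) (use qn in simp)
    ultimately have "((\<lambda>m. ?c * (q ^ Suc n) ^ m) has_sum (?c * (1 / (1 - q ^ Suc n)))) UNIV"
      by (intro norm_summable_imp_has_sum)
    then show "((\<lambda>m. case (n, m) of (n, m) \<Rightarrow> of_nat (Suc n) * (q ^ Suc n) ^ Suc m) has_sum
        of_nat (Suc n) * q ^ Suc n / (1 - q ^ Suc n)) UNIV"
      by (simp add: mult.assoc)
  qed
  then show ?thesis by (rule has_sum_imp_sums)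
qed

text \<open>The eta function without its factor q^(1/24), taken as a function of q so that it can be
  differentiated in the unit disc.\<close>

definition euler_prod :: "complex \<Rightarrow> complex" where
  "euler_prod q = (\<Prod>n. 1 - q ^ Suc n)"

lemma convergent_prod_euler:
  fixes q :: complex
  assumes "norm q < 1"
  shows "convergent_prod (\<lambda>n. 1 - q ^ Suc n)"
proof -
  have "summable (\<lambda>n. norm q ^ Suc n)"
    using assms by (subst summable_Suc_iff) (simp add: summable_geometric)
  then have "summable (\<lambda>n. norm ((1 - q ^ Suc n) - 1))"
    by (simp add: norm_power norm_mult)
  then show ?thesis
    by (intro abs_convergent_prod_imp_convergent_prod summable_imp_abs_convergent_prod)
qed

lemma power_Suc_neq_1:
  fixes q :: complex
  assumes "norm q < 1"
  shows "q ^ Suc n \<noteq> 1"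
proof
  assume "q ^ Suc n = 1"
  then have "norm q ^ Suc n = 1" by (metis norm_one norm_power)
  then show False using assms power_less_one_iff[of "norm q" "Suc n"] by simp
qed

lemma euler_prod_nonzero: "norm q < 1 \<Longrightarrow> euler_prod q \<noteq> 0"
  unfolding euler_prod_def using power_Suc_neq_1
  by (intro prodinf_nonzero convergent_prod_euler) auto

text \<open>The geometric series in r majorizes the deviations of the factors from 1. Uniformity
  makes the product holomorphic and allows termwise logarithmic differentiation.\<close>

lemma uniform_limit_euler_prod:
  assumes "0 \<le> r" "r < 1"
  shows "uniform_limit (cball 0 r) (\<lambda>N q. \<Prod>n<N. 1 - q ^ Suc n) euler_prod sequentially"
proof -
  have "uniformly_convergent_on (cball 0 r) (\<lambda>N q :: complex. \<Prod>n<N. 1 - q ^ Suc n)"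
  proof (rule uniformly_convergent_on_prod')
    show "uniformly_convergent_on (cball 0 r) (\<lambda>N q :: complex. \<Sum>n<N. norm (1 - q ^ Suc n - 1))"
    proof (rule Weierstrass_m_test')
      show "summable (\<lambda>n. r ^ Suc n)"
        using assms by (subst summable_Suc_iff) (simp add: summable_geometric)
    qed (auto simp: norm_power norm_mult intro!: mult_mono power_mono assms)
  qed (auto intro!: continuous_intros)
  then obtain P where P: "uniform_limit (cball 0 r) (\<lambda>N q :: complex. \<Prod>n<N. 1 - q ^ Suc n) P sequentially"
    by (auto simp: uniformly_convergent_on_def)
  have "P q = euler_prod q" if "q \<in> cball 0 r" for q
  proof (rule LIMSEQ_unique)
    show "(\<lambda>N. \<Prod>n<N. 1 - q ^ Suc n) \<longlonglongrightarrow> P q"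
      using P that by (rule tendsto_uniform_limitI)
    show "(\<lambda>N. \<Prod>n<N. 1 - q ^ Suc n) \<longlonglongrightarrow> euler_prod q"
      unfolding euler_prod_def using convergent_prod_euler[of q] that assms
      by (intro has_prod_imp_tendsto' convergent_prod_has_prod) auto
  qed
  then show ?thesis
    using P by (subst uniform_limit_cong'[where g = "\<lambda>N q. \<Prod>n<N. 1 - q ^ Suc n" and i = P]) auto
qed

text \<open>The logarithmic derivative, taken factor by factor and multiplied by -q, is the Lambert
  series of the divisor sums. Stated for q * D, the relation includes q = 0.\<close>

lemma euler_prod_has_field_derivative:
  assumes q: "norm q < 1"
  obtains D where "(euler_prod has_field_derivative D) (at q)"
    "q * D = - eval_fps (divisor_series 1) q * euler_prod q"
proof
  \<comment> \<open>The midpoint of |q| and 1 gives a disc around 0 that contains q and whose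
    closure lies in the unit disc.\<close>
  define r where "r = (norm q + 1) / 2"
  have r: "norm q < r" "r < 1" "0 \<le> r" using q by (auto simp: r_def)
  have lim: "uniform_limit (ball 0 r) (\<lambda>N q. \<Prod>n<N. 1 - q ^ Suc n) euler_prod sequentially"
    using uniform_limit_euler_prod[OF r(3,2)] by (rule uniform_limit_on_subset) auto
  have "euler_prod holomorphic_on ball 0 r"
  proof (rule holomorphic_uniform_limit[OF _ uniform_limit_euler_prod[OF r(3,2)]])
    have "(\<lambda>q :: complex. \<Prod>n<N. 1 - q ^ Suc n) holomorphic_on A" for N A
      by (intro holomorphic_intros)
    then show "\<forall>\<^sub>F N in sequentially. continuous_on (cball 0 r) (\<lambda>q :: complex. \<Prod>n<N. 1 - q ^ Suc n) \<and>
        (\<lambda>q. \<Prod>n<N. 1 - q ^ Suc n) holomorphic_on ball 0 r"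
      by (intro always_eventually allI conjI holomorphic_on_imp_continuous_on)
  qed auto
  then show D: "(euler_prod has_field_derivative deriv euler_prod q) (at q)"
    using r by (intro holomorphic_derivI[where S = "ball 0 r"]) auto
  have "(\<lambda>n. deriv (\<lambda>q. 1 - q ^ Suc n) q / (1 - q ^ Suc n)) sums (deriv euler_prod q / euler_prod q)"
    by (rule logderiv_prodinf_complex_uniform_limit[OF lim])
       (use r euler_prod_nonzero[OF q] in \<open>auto intro!: holomorphic_intros\<close>)
  moreover have "deriv (\<lambda>q. 1 - q ^ Suc n) q = - (of_nat (Suc n) * q ^ n)" for n
    using DERIV_diff[OF DERIV_const[of 1] DERIV_power_Suc[OF DERIV_ident, of n q UNIV]]
    by (intro DERIV_imp_deriv) simp
  ultimately have "(\<lambda>n. - q * (- (of_nat (Suc n) * q ^ n) / (1 - q ^ Suc n))) sums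
      (- q * (deriv euler_prod q / euler_prod q))"
    by (intro sums_mult) simp
  moreover have "- q * (- (of_nat (Suc n) * q ^ n) / (1 - q ^ Suc n)) =
      of_nat (Suc n) * q ^ Suc n / (1 - q ^ Suc n)" for n
    by simp
  ultimately have "(\<lambda>n. of_nat (Suc n) * q ^ Suc n / (1 - q ^ Suc n)) sums
      (- q * (deriv euler_prod q / euler_prod q))"
    by (simp only:)
  then have "- q * (deriv euler_prod q / euler_prod q) = eval_fps (divisor_series 1) q"
    by (rule sums_unique2[OF _ lambert_series_divisor_sum_1[OF q]])
  then show "q * deriv euler_prod q = - eval_fps (divisor_series 1) q * euler_prod q"
    using euler_prod_nonzero[OF q] by (metis (no_types, lifting) minus_mult_left minus_minus nonzero_eq_divide_eq times_divide_eq_right)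
qed

subsection \<open>The identities of Ramanujan and Chazy\<close>

lemma divisor_series_1_squared:
  "12 * divisor_series 1 ^ 2 = 5 * divisor_series 3 - 6 * theta (divisor_series 1) + divisor_series 1"
proof (rule fps_ext)
  fix n
  have "12 * (\<Sum>m\<le>n. of_nat (divisor_sum 1 m) * of_nat (divisor_sum 1 (n - m))) =
    5 * of_nat (divisor_sum 3 n) - (6 * of_nat n - 1) * (of_nat (divisor_sum 1 n) :: complex)"
    using arg_cong[OF sum_divisor_sum_1_1[of n], of "of_int :: int \<Rightarrow> complex"] by simp
  moreover have "fps_nth (divisor_series 1 ^ 2) n =
      (\<Sum>m\<le>n. of_nat (divisor_sum 1 m) * of_nat (divisor_sum 1 (n - m)))"
    by (simp add: power2_eq_square fps_mult_nth atLeast0AtMost)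
  ultimately show "fps_nth (12 * divisor_series 1 ^ 2) n =
    fps_nth (5 * divisor_series 3 - 6 * theta (divisor_series 1) + divisor_series 1) n"
    by (simp add: left_diff_distrib)
qed

lemma theta_divisor_series_1_squared:
  "12 * theta (divisor_series 1) ^ 2 = theta (theta (divisor_series 3 - theta (divisor_series 1)))"
proof (rule fps_ext)
  fix n
  have "12 * (\<Sum>m\<le>n. of_nat m * of_nat (n - m) * of_nat (divisor_sum 1 m) * of_nat (divisor_sum 1 (n - m))) =
    of_nat n ^ 2 * (of_nat (divisor_sum 3 n) - of_nat n * (of_nat (divisor_sum 1 n) :: complex))"
    using arg_cong[OF sum_weighted_divisor_sum_1_1[of n], of "of_int :: int \<Rightarrow> complex"]
    by (simp del: of_nat_diff)
  moreover have "fps_nth (theta (divisor_series 1) ^ 2) n =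
      (\<Sum>m\<le>n. of_nat m * of_nat (n - m) * of_nat (divisor_sum 1 m) * of_nat (divisor_sum 1 (n - m)))"
    by (simp add: power2_eq_square fps_mult_nth atLeast0AtMost mult_ac del: of_nat_diff)
  ultimately show "fps_nth (12 * theta (divisor_series 1) ^ 2) n =
    fps_nth (theta (theta (divisor_series 3 - theta (divisor_series 1)))) n"
    by (simp add: power2_eq_square mult.assoc)
qed

definition E2_series :: "complex fps" where
  "E2_series = 1 - 24 * divisor_series 1"

lemma theta_E2_series: "theta E2_series = - 24 * theta (divisor_series 1)"
  by (simp add: E2_series_def theta_diff theta_mult)

text \<open>With (1 - 24 s)^2 expanded, this is 48 times
  \<open>divisor_series_1_squared\<close>.\<close>

lemma ramanujan_theta_E2: "1 + 240 * divisor_series 3 = E2_series ^ 2 - 12 * theta E2_series"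
  unfolding theta_E2_series unfolding E2_series_def using divisor_series_1_squared by algebra

text \<open>Applying \<open>theta\<close> twice to the first convolution identity brings in the
  second \<open>theta\<close>-derivative of \<open>divisor_series 3\<close>, which the second
  identity eliminates.\<close>

lemma chazy_E2: "2 * theta (theta (theta E2_series)) =
  2 * E2_series * theta (theta E2_series) - 3 * theta E2_series ^ 2"
proof -
  define s where "s = divisor_series 1"
  have neg: "theta (- 24 * f) = - 24 * theta f" for f
    using theta_diff[of 0 "24 * f"] theta_mult[of 24 f] by (simp add: theta_def)
  have "theta (theta (12 * s ^ 2)) = theta (theta (5 * divisor_series 3 - 6 * theta s + s))"
    unfolding s_def divisor_series_1_squared ..
  then have 1: "24 * (theta s ^ 2 + s * theta (theta s)) =
      5 * theta (theta (divisor_series 3)) - 6 * theta (theta (theta s)) + theta (theta s)"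
    by (simp add: theta_add theta_diff theta_mult power2_eq_square algebra_simps)
  have 2: "12 * theta s ^ 2 = theta (theta (divisor_series 3)) - theta (theta (theta s))"
    using theta_divisor_series_1_squared by (simp add: s_def theta_diff)
  show ?thesis
    unfolding theta_E2_series neg s_def[symmetric] unfolding E2_series_def s_def[symmetric]
    using 1 2 by algebra
qed

subsection \<open>Eisenstein series and the eta function\<close>

lemma open_upper_half_plane: "open upper_half_plane"
  by (simp add: upper_half_plane_def open_halfspace_Im_gt)

lemma E4_eq_eval_fps:
  assumes "z \<in> upper_half_plane"
  shows "E4 z = eval_fps (1 + 240 * divisor_series 3) (nome z)"
proof -
  have *: "norm (nome z) < fps_conv_radius (divisor_series 3)"
    by (intro norm_less_fps_conv_radius norm_nome_less_1 fps_conv_radius_divisor_series assms)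
  moreover have "(\<Sum>n. of_nat (divisor_sum 3 (Suc n)) * nome z ^ Suc n) = eval_fps (divisor_series 3) (nome z)"
    using sums_eval_fps[OF *] sums_Suc_iff[of "\<lambda>n. of_nat (divisor_sum 3 n) * nome z ^ n"
        "eval_fps (divisor_series 3) (nome z)"]
    by (simp add: sums_iff)
  ultimately show ?thesis
    by (simp add: E4_def eval_fps_unit_disc fps_conv_radius_ge_1_intros fps_conv_radius_divisor_series
        norm_nome_less_1[OF assms])
qed

lemma fps_conv_radius_E2_series: "1 \<le> fps_conv_radius E2_series"
  by (simp add: E2_series_def fps_conv_radius_ge_1_intros fps_conv_radius_divisor_series)

section \<open>Derivatives of eta and of its power -12\<close>

definition E2 :: "complex \<Rightarrow> complex" where
  "E2 z = eval_fps E2_series (nome z)"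

lemma dedekind_eta_nonzero: "z \<in> upper_half_plane \<Longrightarrow> dedekind_eta z \<noteq> 0"
  using euler_prod_nonzero[OF norm_nome_less_1]
  by (simp add: dedekind_eta_def euler_prod_def qpow_def)

text \<open>The prefactor contributes 1/24 and the Euler product minus the divisor series to the
  logarithmic derivative; together they are E2 / 24.\<close>

lemma dedekind_eta_has_field_derivative:
  assumes z: "z \<in> upper_half_plane"
  shows "(dedekind_eta has_field_derivative
    2 * of_real pi * \<i> / 24 * E2 z * dedekind_eta z) (at z)"
proof -
  have eta: "dedekind_eta w = qpow (1 / 24) w * euler_prod (nome w)" for w
    by (simp add: dedekind_eta_def euler_prod_def)
  from euler_prod_has_field_derivative[OF norm_nome_less_1[OF z]] obtain D where
    D: "(euler_prod has_field_derivative D) (at (nome z))" and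
    D_eq: "nome z * D = - eval_fps (divisor_series 1) (nome z) * euler_prod (nome z)" .
  have E2: "E2 z = 1 - 24 * eval_fps (divisor_series 1) (nome z)"
    by (simp add: E2_def E2_series_def eval_fps_unit_disc fps_conv_radius_ge_1_intros
        fps_conv_radius_divisor_series norm_nome_less_1[OF z])
  have "((\<lambda>w. euler_prod (nome w)) has_field_derivative D * (2 * of_real pi * \<i> * of_real 1 * nome z)) (at z)"
    using DERIV_chain2[where f = euler_prod and g = nome and x = z, OF D qpow_has_field_derivative] .
  then have "((\<lambda>w. qpow (1 / 24) w * euler_prod (nome w)) has_field_derivative
      2 * of_real pi * \<i> * of_real (1 / 24) * qpow (1 / 24) z * euler_prod (nome z) +
      D * (2 * of_real pi * \<i> * of_real 1 * nome z) * qpow (1 / 24) z) (at z)"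
    by (intro DERIV_mult qpow_has_field_derivative)
  also have "2 * of_real pi * \<i> * of_real (1 / 24) * qpow (1 / 24) z * euler_prod (nome z) +
      D * (2 * of_real pi * \<i> * of_real 1 * nome z) * qpow (1 / 24) z =
      2 * of_real pi * \<i> * qpow (1 / 24) z * (euler_prod (nome z) / 24 + nome z * D)"
    by (simp add: field_simps)
  also have "\<dots> = 2 * of_real pi * \<i> / 24 * E2 z * dedekind_eta z"
    unfolding D_eq E2 eta by (simp add: field_simps)
  finally show ?thesis
    by (simp add: eta[abs_def])
qed

text \<open>The power -12 multiplies the logarithmic derivative of eta by -12, and -12 * 2 pi i / 24
  = - pi i.\<close>

lemma Delta_inv_sqrt_has_field_derivative:
  assumes z: "z \<in> upper_half_plane"
  shows "(Delta_inv_sqrt has_field_derivative - of_real pi * \<i> * E2 z * Delta_inv_sqrt z) (at z)"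
proof -
  have "((\<lambda>w. inverse (dedekind_eta w)) has_field_derivative
      - (2 * of_real pi * \<i> / 24 * E2 z * inverse (dedekind_eta z))) (at z)"
    using dedekind_eta_nonzero[OF z]
    by (auto intro!: derivative_eq_intros dedekind_eta_has_field_derivative[OF z]
        simp: field_simps power2_eq_square)
  from DERIV_power[OF this, of 12]
  have "((\<lambda>w. inverse (dedekind_eta w) ^ 12) has_field_derivative
      12 * (- (2 * of_real pi * \<i> / 24 * E2 z * inverse (dedekind_eta z)) * inverse (dedekind_eta z) ^ 11)) (at z)"
    by simp
  also have "12 * (- (2 * of_real pi * \<i> / 24 * E2 z * inverse (dedekind_eta z)) * inverse (dedekind_eta z) ^ 11) =
      - of_real pi * \<i> * E2 z * inverse (dedekind_eta z) ^ Suc 11"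
    unfolding power_Suc by simp
  finally have "((\<lambda>w. inverse (dedekind_eta w) ^ 12) has_field_derivative
      - of_real pi * \<i> * E2 z * inverse (dedekind_eta z) ^ 12) (at z)"
    by simp
  then show ?thesis
    by (simp add: Delta_inv_sqrt_def[abs_def] power_int_minus power_inverse)
qed

section \<open>The differential equation\<close>

theorem theorem5p1:
  fixes y :: "complex \<Rightarrow> complex"
  defines "y \<equiv> (\<lambda>z. deriv E4 z * Delta_inv_sqrt z)"
  shows "y holomorphic_on upper_half_plane \<and>
    (\<forall>z\<in>upper_half_plane. deriv (deriv y) z + of_real pi ^ 2 * E4 z * y z = 0)"
proof -
  \<comment> \<open>Here d/dz is c times q d/dq, and \<open>p k\<close> is the k-th iterate of q
    d/dq on E2. Everything becomes a polynomial in the \<open>p k\<close> times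
    \<open>?e\<close>.\<close>
  define c :: complex where "c = 2 * of_real pi * \<i>"
  define p where "p k z = eval_fps ((theta ^^ k) E2_series) (nome z)" for k z
  let ?e = Delta_inv_sqrt
  \<comment> \<open>The closed formulas hold on the upper half-plane only; since it is open, they
    can still be differentiated there.\<close>
  note transform = has_field_derivative_transform_within_open[OF _ open_upper_half_plane]
  have radius: "1 \<le> fps_conv_radius ((theta ^^ k) E2_series)" for k
    by (induction k) (auto intro: fps_conv_radius_E2_series order_trans[OF _ fps_conv_radius_theta])
  have E2: "E2 = p 0"
    by (simp add: p_def E2_def fun_eq_iff)
  have dp: "(p k has_field_derivative c * p (Suc k) z) (at z)" if "z \<in> upper_half_plane" for k z
    using eval_fps_nome_has_field_derivative[OF radius that] by (simp add: p_def[abs_def] c_def)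
  have de: "(?e has_field_derivative - (c / 2) * p 0 z * ?e z) (at z)" if "z \<in> upper_half_plane" for z
    using Delta_inv_sqrt_has_field_derivative[OF that] by (simp add: c_def E2)
  have E4: "E4 z = p 0 z ^ 2 - 12 * p 1 z"
    and p3: "2 * p 3 z = 2 * p 0 z * p 2 z - 3 * p 1 z ^ 2" if z: "z \<in> upper_half_plane" for z
  proof -
    note eval = eval_fps_unit_disc[OF norm_nome_less_1[OF z]] fps_conv_radius_ge_1_intros radius
    have "E4 z = eval_fps ((theta ^^ 0) E2_series * (theta ^^ 0) E2_series - 12 * (theta ^^ 1) E2_series) (nome z)"
      unfolding E4_eq_eval_fps[OF z] ramanujan_theta_E2 by (simp add: power2_eq_square)
    then show "E4 z = p 0 z ^ 2 - 12 * p 1 z"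
      unfolding p_def by (simp add: eval power2_eq_square del: funpow.simps funpow_0)
    have "2 * (theta ^^ 3) E2_series = 2 * (theta ^^ 0) E2_series * (theta ^^ 2) E2_series
        - 3 * ((theta ^^ 1) E2_series * (theta ^^ 1) E2_series)"
      using chazy_E2 by (simp add: eval_nat_numeral)
    from arg_cong[OF this, of "\<lambda>f. eval_fps f (nome z)"]
    show "2 * p 3 z = 2 * p 0 z * p 2 z - 3 * p 1 z ^ 2"
      unfolding p_def by (simp add: eval power2_eq_square del: funpow.simps funpow_0)
  qed
  have dE4: "deriv E4 z = c * (2 * p 0 z * p 1 z - 12 * p 2 z)" if z: "z \<in> upper_half_plane" for z
  proof (rule DERIV_imp_deriv, rule transform[OF _ z])
    show "((\<lambda>z. p 0 z ^ 2 - 12 * p 1 z) has_field_derivative c * (2 * p 0 z * p 1 z - 12 * p 2 z)) (at z)"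
      by (auto intro!: derivative_eq_intros dp[OF z] simp: algebra_simps numeral_2_eq_2)
  qed (simp add: E4)
  have dy: "(y has_field_derivative
      c ^ 2 * ((20 * p 1 z ^ 2 - 4 * p 0 z * p 2 z - p 0 z ^ 2 * p 1 z) * ?e z)) (at z)"
    if z: "z \<in> upper_half_plane" for z
  proof (rule transform[OF _ z])
    have "((\<lambda>z. c * (2 * p 0 z * p 1 z - 12 * p 2 z) * ?e z) has_field_derivative
      c * (2 * (c * p (Suc 0) z * p 1 z + c * p (Suc 1) z * p 0 z) - 12 * (c * p (Suc 2) z)) * ?e z
        + (- (c / 2) * p 0 z * ?e z) * (c * (2 * p 0 z * p 1 z - 12 * p 2 z))) (at z)"
      by (auto intro!: derivative_eq_intros dp[OF z] de[OF z] simp: algebra_simps)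
    \<comment> \<open>The derivative is the target plus a multiple of Chazy's relation, so
      \<open>p3\<close> removes the third derivative of E2.\<close>
    also have "c * (2 * (c * p (Suc 0) z * p 1 z + c * p (Suc 1) z * p 0 z) - 12 * (c * p (Suc 2) z)) * ?e z
        + (- (c / 2) * p 0 z * ?e z) * (c * (2 * p 0 z * p 1 z - 12 * p 2 z)) =
        c ^ 2 * ((20 * p 1 z ^ 2 - 4 * p 0 z * p 2 z - p 0 z ^ 2 * p 1 z) * ?e z)
        - 6 * c ^ 2 * ?e z * (2 * p 3 z - (2 * p 0 z * p 2 z - 3 * p 1 z ^ 2))"
      by (simp add: field_simps power2_eq_square eval_nat_numeral(2,3))
    finally show "((\<lambda>z. c * (2 * p 0 z * p 1 z - 12 * p 2 z) * ?e z) has_field_derivative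
      c ^ 2 * ((20 * p 1 z ^ 2 - 4 * p 0 z * p 2 z - p 0 z ^ 2 * p 1 z) * ?e z)) (at z)"
      by (simp add: p3[OF z])
  qed (simp add: y_def dE4)
  have ddy: "deriv (deriv y) z + of_real pi ^ 2 * E4 z * y z = 0" if z: "z \<in> upper_half_plane" for z
  proof -
    \<comment> \<open>\<open>?P\<close> is q d/dq of the polynomial factor in y'.\<close>
    let ?P = "40 * p 1 z * p 2 z - 4 * (p 1 z * p 2 z + p 0 z * p 3 z)
      - (2 * p 0 z * p 1 z ^ 2 + p 0 z ^ 2 * p 2 z)"
    have Suc: "Suc 0 = 1" "Suc 1 = 2" "Suc 2 = 3" by simp_all
    have "(deriv y has_field_derivative c ^ 2 * (c * ?P * ?e z
        + (20 * p 1 z ^ 2 - 4 * p 0 z * p 2 z - p 0 z ^ 2 * p 1 z) * (- (c / 2) * p 0 z * ?e z))) (at z)"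
    proof (rule transform[OF _ z])
      show "((\<lambda>z. c ^ 2 * ((20 * p 1 z ^ 2 - 4 * p 0 z * p 2 z - p 0 z ^ 2 * p 1 z) * ?e z))
        has_field_derivative c ^ 2 * (c * ?P * ?e z
        + (20 * p 1 z ^ 2 - 4 * p 0 z * p 2 z - p 0 z ^ 2 * p 1 z) * (- (c / 2) * p 0 z * ?e z))) (at z)"
        using dp[OF z, of 0] dp[OF z, of 1] dp[OF z, of 2] unfolding Suc
        by (auto intro!: derivative_eq_intros de[OF z] simp: algebra_simps power2_eq_square)
    qed (simp add: DERIV_imp_deriv[OF dy])
    then have 1: "deriv (deriv y) z = c ^ 2 * (c * ?P * ?e z
        + (20 * p 1 z ^ 2 - 4 * p 0 z * p 2 z - p 0 z ^ 2 * p 1 z) * (- (c / 2) * p 0 z * ?e z))"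
      by (rule DERIV_imp_deriv)
    have 2: "y z = c * (2 * p 0 z * p 1 z - 12 * p 2 z) * ?e z"
      by (simp add: y_def dE4[OF z])
    have 3: "(of_real pi)^2 = - (c ^ 2) / 4"
      by (simp add: c_def power_mult_distrib)
    \<comment> \<open>The left-hand side is a multiple of Chazy's relation, hence zero.\<close>
    have "deriv (deriv y) z + of_real pi ^ 2 * E4 z * y z =
        - 2 * c ^ 3 * p 0 z * ?e z * (2 * p 3 z - (2 * p 0 z * p 2 z - 3 * p 1 z ^ 2))"
      unfolding 1 2 3 E4[OF z] by (simp add: field_simps power2_eq_square power3_eq_cube)
    then show ?thesis by (simp add: p3[OF z])
  qed
  have "y holomorphic_on upper_half_plane"
    using dy open_upper_half_plane by (auto simp: holomorphic_on_open)
  with ddy show ?thesis by blast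
qed

end
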